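(* Let $q\geq 5$ be a prime power with $p=\operatorname{char}(\mathbb{F}_q)>3$. There exists a smooth blocking plane curve over $\mathbb{F}_q$ with degree $d=\frac{q+3}{2}$.
   Context: A plane curve $C=\{F=0\}\subset\mathbb{P}^2$ of degree $d$ over $\mathbb{F}_q$ is given by a nonzero homogeneous polynomial $F\in\mathbb{F}_q[x,y,z]$ of degree $d$. It is smooth if at every point $P\in C$ (over $\overline{\mathbb{F}_q}$) at least one of the partial derivatives $F_x,F_y,F_z$ does not vanish. $C(\mathbb{F}_q)$ is the set of points $[x:y:z]\in\mathbb{P}^2(\mathbb{F}_q)$ with $F(x,y,z)=0$. A set $B\subseteq\mathbb{P}^2(\mathbb{F}_q)$ is a blocking set if every line of $\mathbb{P}^2$ defined over $\mathbb{F}_q$ (an $\mathbb{F}_q$-line) contains a point of $B$. The curve $C$ is blocking (over $\mathbb{F}_q$) if $C(\mathbb{F}_q)$ is a blocking set. *)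

theory Defs
  imports
    "HOL-Algebra.Algebraic_Closure_Type"
    "HOL-Number_Theory.Prime_Powers"
    "HOL-Library.Poly_Mapping"
    "HOL-Library.Product_Plus"
    "HOL-Library.Cardinality"
begin

text \<open>
  Polynomials in three variables: \<open>Poly_Mapping.lookup F (i, j, k)\<close> is the coefficient of
  \<open>x ^ i * y ^ j * z ^ k\<close>. With the componentwise addition of exponents the type below
  carries the usual polynomial ring structure.
\<close>

type_synonym 'a poly3 = "(nat \<times> nat \<times> nat) \<Rightarrow>\<^sub>0 'a"

definition eval3 :: "'a::comm_semiring_1 poly3 \<Rightarrow> 'a \<times> 'a \<times> 'a \<Rightarrow> 'a" where
  "eval3 F = (\<lambda>(x, y, z). \<Sum>(i, j, k)\<in>Poly_Mapping.keys F. Poly_Mapping.lookup F (i, j, k) * x ^ i * y ^ j * z ^ k)"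

definition homogeneous3 :: "nat \<Rightarrow> 'a::zero poly3 \<Rightarrow> bool" where
  "homogeneous3 d F \<longleftrightarrow> (\<forall>(i, j, k)\<in>Poly_Mapping.keys F. i + j + k = d)"

text \<open>
  Formal partial derivatives. The truncation \<open>0 - 1 = 0\<close> in an exponent is harmless,
  since the coefficient of such a term is 0.
\<close>

definition pderiv_x :: "'a::comm_semiring_1 poly3 \<Rightarrow> 'a poly3" where
  "pderiv_x F = (\<Sum>(i, j, k)\<in>Poly_Mapping.keys F. Poly_Mapping.single (i - 1, j, k) (of_nat i * Poly_Mapping.lookup F (i, j, k)))"

definition pderiv_y :: "'a::comm_semiring_1 poly3 \<Rightarrow> 'a poly3" where
  "pderiv_y F = (\<Sum>(i, j, k)\<in>Poly_Mapping.keys F. Poly_Mapping.single (i, j - 1, k) (of_nat j * Poly_Mapping.lookup F (i, j, k)))"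

definition pderiv_z :: "'a::comm_semiring_1 poly3 \<Rightarrow> 'a poly3" where
  "pderiv_z F = (\<Sum>(i, j, k)\<in>Poly_Mapping.keys F. Poly_Mapping.single (i, j, k - 1) (of_nat k * Poly_Mapping.lookup F (i, j, k)))"

text \<open>
  The point \<open>[x : y : z]\<close> of the projective plane over \<open>'a\<close> is the set of all its
  homogeneous coordinate triples.
\<close>

definition hpoint :: "'a::field \<times> 'a \<times> 'a \<Rightarrow> ('a \<times> 'a \<times> 'a) set" where
  "hpoint = (\<lambda>(x, y, z). {(c * x, c * y, c * z) |c. c \<noteq> 0})"

definition proj_plane :: "('a::field \<times> 'a \<times> 'a) set set" where
  "proj_plane = {hpoint v |v. v \<noteq> (0, 0, 0)}"

definition proj_line :: "'a::field \<times> 'a \<times> 'a \<Rightarrow> ('a \<times> 'a \<times> 'a) set set" where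
  "proj_line = (\<lambda>(a, b, c). {P \<in> proj_plane. \<forall>(x, y, z)\<in>P. a * x + b * y + c * z = 0})"

definition proj_lines :: "('a::field \<times> 'a \<times> 'a) set set set" where
  "proj_lines = {proj_line w |w. w \<noteq> (0, 0, 0)}"

definition blocking_set :: "('a::field \<times> 'a \<times> 'a) set set \<Rightarrow> bool" where
  "blocking_set B \<longleftrightarrow> B \<subseteq> proj_plane \<and> (\<forall>L\<in>proj_lines. L \<inter> B \<noteq> {})"

text \<open>
  For homogeneous \<open>F\<close>, vanishing at one coordinate triple of \<open>P\<close> is the same as
  vanishing at all of them; see \<open>vanishes_at_hpoint_iff\<close> below.
\<close>

definition vanishes_at :: "'a::field poly3 \<Rightarrow> ('a \<times> 'a \<times> 'a) set \<Rightarrow> bool" where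
  "vanishes_at F P \<longleftrightarrow> (\<forall>v\<in>P. eval3 F v = 0)"

definition curve_points :: "'a::field poly3 \<Rightarrow> ('a \<times> 'a \<times> 'a) set set" where
  "curve_points F = {P \<in> proj_plane. vanishes_at F P}"

definition plane_curve :: "nat \<Rightarrow> 'a::field poly3 \<Rightarrow> bool" where
  "plane_curve d F \<longleftrightarrow> F \<noteq> 0 \<and> homogeneous3 d F"

definition base_change_ac :: "'a::field poly3 \<Rightarrow> 'a alg_closure poly3" where
  "base_change_ac F = Poly_Mapping.map to_ac F"

definition smooth_curve :: "'a::field poly3 \<Rightarrow> bool" where
  "smooth_curve F \<longleftrightarrow>
     (\<forall>P\<in>curve_points (base_change_ac F).
        \<not> vanishes_at (pderiv_x (base_change_ac F)) P \<or>
        \<not> vanishes_at (pderiv_y (base_change_ac F)) P \<or>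
        \<not> vanishes_at (pderiv_z (base_change_ac F)) P)"

definition blocking_curve :: "'a::field poly3 \<Rightarrow> bool" where
  "blocking_curve F \<longleftrightarrow> blocking_set (curve_points F)"

lemma eval3_scale:
  assumes "homogeneous3 d F"
  shows "eval3 F (c * x, c * y, c * z) = c ^ d * eval3 F (x, y, z)"
  unfolding eval3_def prod.case sum_distrib_left
proof (rule sum.cong[OF refl], clarify)
  fix i j k
  assume "(i, j, k) \<in> Poly_Mapping.keys F"
  with assms have "d = i + j + k"
    by (auto simp: homogeneous3_def)
  then show "Poly_Mapping.lookup F (i, j, k) * (c * x) ^ i * (c * y) ^ j * (c * z) ^ k =
      c ^ d * (Poly_Mapping.lookup F (i, j, k) * x ^ i * y ^ j * z ^ k)"
    by (simp add: power_mult_distrib power_add mult_ac)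
qed

lemma vanishes_at_hpoint_iff:
  assumes "homogeneous3 d F"
  shows "vanishes_at F (hpoint v) \<longleftrightarrow> eval3 F v = 0"
proof (cases v)
  case (fields x y z)
  have "(1 * x, 1 * y, 1 * z) \<in> hpoint v"
    unfolding hpoint_def fields prod.case using one_neq_zero by blast
  then have "eval3 F v = 0" if "vanishes_at F (hpoint v)"
    using that by (simp add: vanishes_at_def fields)
  moreover have "vanishes_at F (hpoint v)" if "eval3 F v = 0"
    using that eval3_scale[OF assms, of _ x y z]
    by (simp add: vanishes_at_def hpoint_def fields) blast
  ultimately show ?thesis
    by blast
qed

lemma lookup_pderiv_x: "Poly_Mapping.lookup (pderiv_x F) (i, j, k) = of_nat (Suc i) * Poly_Mapping.lookup F (Suc i, j, k)"
proof -
  have "Poly_Mapping.lookup (pderiv_x F) (i, j, k) =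
      (\<Sum>m\<in>Poly_Mapping.keys F. if m = (Suc i, j, k) then of_nat (Suc i) * Poly_Mapping.lookup F (Suc i, j, k) else 0)"
    unfolding pderiv_x_def lookup_sum
    by (rule sum.cong) (auto simp: lookup_single when_def split: prod.splits nat_diff_split)
  then show ?thesis
    by (simp add: in_keys_iff)
qed

lemma lookup_pderiv_y: "Poly_Mapping.lookup (pderiv_y F) (i, j, k) = of_nat (Suc j) * Poly_Mapping.lookup F (i, Suc j, k)"
proof -
  have "Poly_Mapping.lookup (pderiv_y F) (i, j, k) =
      (\<Sum>m\<in>Poly_Mapping.keys F. if m = (i, Suc j, k) then of_nat (Suc j) * Poly_Mapping.lookup F (i, Suc j, k) else 0)"
    unfolding pderiv_y_def lookup_sum
    by (rule sum.cong) (auto simp: lookup_single when_def split: prod.splits nat_diff_split)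
  then show ?thesis
    by (simp add: in_keys_iff)
qed

lemma lookup_pderiv_z: "Poly_Mapping.lookup (pderiv_z F) (i, j, k) = of_nat (Suc k) * Poly_Mapping.lookup F (i, j, Suc k)"
proof -
  have "Poly_Mapping.lookup (pderiv_z F) (i, j, k) =
      (\<Sum>m\<in>Poly_Mapping.keys F. if m = (i, j, Suc k) then of_nat (Suc k) * Poly_Mapping.lookup F (i, j, Suc k) else 0)"
    unfolding pderiv_z_def lookup_sum
    by (rule sum.cong) (auto simp: lookup_single when_def split: prod.splits nat_diff_split)
  then show ?thesis
    by (simp add: in_keys_iff)
qed

lemma lookup_base_change_ac: "Poly_Mapping.lookup (base_change_ac F) m = to_ac (Poly_Mapping.lookup F m)"
  by (simp add: base_change_ac_def Poly_Mapping.map.rep_eq when_def)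

end

theory Submission
  imports Defs "HOL-Number_Theory.Residues"
begin

text \<open>
  Put \<open>q = 2 m + 1\<close>. A projective triangle, consisting of the vertices of \<open>x y z = 0\<close> and of the points of
  its sides whose coordinate quotients lie in suitable cosets of the squares, is a blocking set,
  because a line missing the vertices meets the sides in points whose quotients have product \<open>- 1\<close>. A curve
  of degree \<open>m + 2\<close> that meets each side exactly in the \<open>m + 2\<close> points of the triangle is smooth there.

  Away from the sides write \<open>u = x\<^sup>m\<close>, \<open>v = y\<^sup>m\<close> in the chart \<open>z = 1\<close>. The singularity equations are polynomial in
  \<open>x, y, u, v\<close>, with \<open>m\<close> acting as \<open>- 1/2\<close>, and the Frobenius map acts by \<open>x\<^sup>q = x u\<^sup>2\<close>,
  \<open>y\<^sup>q = y v\<^sup>2\<close>. Hence a singular point satisfies a system of equations that does not depend on \<open>q\<close>.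
  The remaining coefficient \<open>\<epsilon>\<close> is chosen so that this system is inconsistent: \<open>1/5\<close> for odd \<open>m\<close>, and
  for even \<open>m\<close> it is \<open>0\<close>, or \<open>- 1\<close> in characteristic 7.
\<close>

subsection \<open>Curves through a projective triangle\<close>

lemma eval3_superset:
  assumes "finite A" "Poly_Mapping.keys F \<subseteq> A"
  shows "eval3 F (x, y, z) = (\<Sum>(i, j, k)\<in>A. Poly_Mapping.lookup F (i, j, k) * x ^ i * y ^ j * z ^ k)"
  unfolding eval3_def prod.case
  using assms by (intro sum.mono_neutral_left) (auto simp: in_keys_iff)

lemma eval3_add: "eval3 (F + G) v = eval3 F v + eval3 G v"
proof (cases v)
  case (fields x y z)
  let ?A = "Poly_Mapping.keys F \<union> Poly_Mapping.keys G"
  have "eval3 H v = (\<Sum>(i, j, k)\<in>?A. Poly_Mapping.lookup H (i, j, k) * x ^ i * y ^ j * z ^ k)"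
    if "Poly_Mapping.keys H \<subseteq> ?A" for H
    unfolding fields by (rule eval3_superset[OF _ that]) simp
  from this[OF Poly_Mapping.keys_add] this[OF Un_upper1] this[OF Un_upper2]
  show ?thesis
    by (simp add: lookup_add case_prod_unfold distrib_right sum.distrib)
qed

lemma eval3_single: "eval3 (Poly_Mapping.single (i, j, k) c) (x, y, z) = c * x ^ i * y ^ j * z ^ k"
  by (simp add: eval3_def)

lemma pderiv_add:
  "pderiv_x (F + G) = pderiv_x F + pderiv_x G"
  "pderiv_y (F + G) = pderiv_y F + pderiv_y G"
  "pderiv_z (F + G) = pderiv_z F + pderiv_z G"
  by (rule poly_mapping_eqI; clarify;
      simp only: lookup_add lookup_pderiv_x lookup_pderiv_y lookup_pderiv_z distrib_left)+

lemma pderiv_single: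
  "pderiv_x (Poly_Mapping.single (i, j, k) c) = Poly_Mapping.single (i - 1, j, k) (of_nat i * c)"
  "pderiv_y (Poly_Mapping.single (i, j, k) c) = Poly_Mapping.single (i, j - 1, k) (of_nat j * c)"
  "pderiv_z (Poly_Mapping.single (i, j, k) c) = Poly_Mapping.single (i, j, k - 1) (of_nat k * c)"
  by (simp_all add: pderiv_x_def pderiv_y_def pderiv_z_def)

lemma base_change_ac_add: "base_change_ac (F + G) = base_change_ac F + base_change_ac G"
  by (rule poly_mapping_eqI) (simp add: lookup_base_change_ac lookup_add)

lemma base_change_ac_single: "base_change_ac (Poly_Mapping.single n c) = Poly_Mapping.single n (to_ac c)"
  by (rule poly_mapping_eqI) (simp add: lookup_base_change_ac lookup_single when_def)

lemma homogeneous3_add: "homogeneous3 d F \<Longrightarrow> homogeneous3 d G \<Longrightarrow> homogeneous3 d (F + G)"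
  unfolding homogeneous3_def by (auto dest!: subsetD[OF Poly_Mapping.keys_add])

lemma homogeneous3_single: "i + j + k = d \<Longrightarrow> homogeneous3 d (Poly_Mapping.single (i, j, k) c)"
  by (simp add: homogeneous3_def)

section \<open>The triangle curve and its blocking property\<close>

text \<open>
  The three sides of the triangle \<open>x y z = 0\<close> meet this curve, for \<open>m = (q - 1) / 2\<close> and
  \<open>\<sigma> = - (- 1)\<^sup>m\<close>, exactly in a projective triangle; \<open>\<epsilon>\<close> is the coefficient of \<open>x\<^sup>m y z\<close>, which
  does not influence the sides.
\<close>

definition triangle_curve :: "nat \<Rightarrow> 'a::comm_ring_1 \<Rightarrow> 'a \<Rightarrow> 'a poly3" where
  "triangle_curve m \<sigma> \<epsilon> =
     Poly_Mapping.single (1, m + 1, 0) 1 + Poly_Mapping.single (1, m, 1) 1 + Poly_Mapping.single (0, m + 1, 1) 1 +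
     Poly_Mapping.single (1, 1, m) 1 + Poly_Mapping.single (1, 0, m + 1) 1 + Poly_Mapping.single (0, 1, m + 1) 1 +
     Poly_Mapping.single (m + 1, 0, 1) 1 + Poly_Mapping.single (m + 1, 1, 0) \<sigma> + Poly_Mapping.single (m, 1, 1) \<epsilon>"

lemma eval3_triangle_curve:
  "eval3 (triangle_curve m \<sigma> \<epsilon>) (x, y, z) =
    (y ^ m + z ^ m) * (x * (y + z) + y * z) + x ^ m * (x * (z + \<sigma> * y) + \<epsilon> * y * z)"
  by (simp add: triangle_curve_def eval3_add eval3_single algebra_simps)

lemma eval3_pderiv_triangle_curve:
  "eval3 (pderiv_x (triangle_curve m \<sigma> \<epsilon>)) (x, y, z) =
    (y ^ m + z ^ m) * (y + z) + of_nat (m + 1) * x ^ m * (z + \<sigma> * y) + of_nat m * x ^ (m - 1) * \<epsilon> * y * z"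
  "eval3 (pderiv_y (triangle_curve m \<sigma> \<epsilon>)) (x, y, z) =
    of_nat (m + 1) * y ^ m * (x + z) + of_nat m * x * y ^ (m - 1) * z + z ^ m * (x + z) + x ^ m * (\<sigma> * x + \<epsilon> * z)"
  "eval3 (pderiv_z (triangle_curve m \<sigma> \<epsilon>)) (x, y, z) =
    of_nat (m + 1) * z ^ m * (x + y) + of_nat m * x * y * z ^ (m - 1) + y ^ m * (x + y) + x ^ m * (x + \<epsilon> * y)"
  by (simp_all add: triangle_curve_def pderiv_add pderiv_single eval3_add eval3_single algebra_simps)

lemma homogeneous3_triangle_curve: "homogeneous3 (m + 2) (triangle_curve m \<sigma> \<epsilon>)"
  unfolding triangle_curve_def by (intro homogeneous3_add homogeneous3_single) simp_all

lemma plane_curve_triangle_curve: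
  assumes "m \<ge> 2"
  shows "plane_curve (m + 2) (triangle_curve m \<sigma> (\<epsilon> :: 'a::field))"
proof -
  have "Poly_Mapping.lookup (triangle_curve m \<sigma> \<epsilon>) (1, 0, m + 1) = 1"
    using assms by (simp add: triangle_curve_def lookup_add lookup_single when_def)
  then have "triangle_curve m \<sigma> \<epsilon> \<noteq> 0"
    by (metis lookup_zero zero_neq_one)
  then show ?thesis
    using homogeneous3_triangle_curve[of m \<sigma> \<epsilon>] unfolding plane_curve_def by blast
qed

lemma base_change_triangle_curve:
  "base_change_ac (triangle_curve m \<sigma> \<epsilon>) = triangle_curve m (to_ac \<sigma>) (to_ac \<epsilon>)"
  by (simp add: triangle_curve_def base_change_ac_add base_change_ac_single)

lemma blocking_triangle_curve:
  fixes \<epsilon> :: "'a::finite_field"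
  assumes card: "CARD('a) = 2 * m + 1" and m: "m \<ge> 2" and two: "(2::'a) \<noteq> 0"
  shows "blocking_curve (triangle_curve m (- ((- 1) ^ m)) \<epsilon>)"
proof -
  define F where "F = triangle_curve m (- ((- 1) ^ m)) \<epsilon>"
  define s :: 'a where "s = (- 1) ^ m"
  have s: "s = 1 \<or> s = - 1"
    by (simp add: s_def power_minus1_even minus_one_power_iff)
  have chi: "a ^ m = 1 \<or> a ^ m = - 1" if "a \<noteq> 0" for a :: 'a
  proof -
    have "a ^ (2 * m + 1) = a"
      using finite_field_power_card_eq_same[of a] card by simp
    then have "a * ((a ^ m) ^ 2 - 1) = 0"
      by (simp add: algebra_simps power_mult power2_eq_square power_add mult_2)
    with that show ?thesis
      by (simp add: power2_eq_1_iff)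
  qed
  have neg: "(- a) ^ m = s * a ^ m" for a :: 'a
    by (simp add: s_def flip: power_mult_distrib)
  have hom: "homogeneous3 (m + 2) F"
    unfolding F_def by (rule homogeneous3_triangle_curve)
  have meets: "proj_line (a, b, c) \<inter> curve_points F \<noteq> {}"
    if "(x, y, z) \<noteq> (0, 0, 0)" "a * x + b * y + c * z = 0" "eval3 F (x, y, z) = 0" for a b c x y z
  proof -
    have "hpoint (x, y, z) \<in> proj_plane"
      using that(1) by (auto simp: proj_plane_def)
    moreover have "a * (t * x) + b * (t * y) + c * (t * z) = 0" for t
      using that(2) by (metis (no_types, lifting) distrib_left mult.left_commute mult_zero_right)
    ultimately have "hpoint (x, y, z) \<in> proj_line (a, b, c) \<inter> curve_points F"
      using that(3) vanishes_at_hpoint_iff[OF hom]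
      by (auto simp: proj_line_def curve_points_def hpoint_def)
    then show ?thesis
      by blast
  qed
  have "proj_line (a, b, c) \<inter> curve_points F \<noteq> {}" if "(a, b, c) \<noteq> (0, 0, 0)" for a b c
  proof -
    have eval: "eval3 F (x, y, z) =
        (y ^ m + z ^ m) * (x * (y + z) + y * z) + x ^ m * (x * (z - s * y) + \<epsilon> * y * z)" for x y z
      by (simp add: F_def eval3_triangle_curve s_def)
    have m0: "(0::'a) ^ m = 0"
      using m by simp
    consider "a = 0" | "b = 0" | "c = 0" | "a \<noteq> 0" "b \<noteq> 0" "c \<noteq> 0"
      by blast
    then show ?thesis
    proof cases
      case 1
      then show ?thesis
        by (intro meets[of 1 0 0]) (auto simp: eval m0)
    next
      case 2
      then show ?thesis
        by (intro meets[of 0 1 0]) (auto simp: eval m0)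
    next
      case 3
      then show ?thesis
        by (intro meets[of 0 0 1]) (auto simp: eval m0)
    next
      case 4
      \<comment> \<open>The first two conditions both fail only if \<open>c ^ m\<close> equals
        \<open>s * b ^ m\<close> and \<open>s * a ^ m\<close>; then \<open>a ^ m = b ^ m\<close>,
        which is the third.\<close>
      consider "c ^ m + (- b) ^ m = 0" | "c ^ m + (- a) ^ m = 0" | "(- a) ^ m - s * b ^ m = 0"
        using chi[OF 4(1)] chi[OF 4(2)] chi[OF 4(3)] s two by (auto simp: neg)
      then show ?thesis
      proof cases
        case 1
        then show ?thesis
          using 4 by (intro meets[of 0 c "- b"]) (auto simp: eval m0)
      next
        case 2
        moreover have "eval3 F (c, 0, - a) = - (a * c) * (c ^ m + (- a) ^ m)"
          by (simp add: eval m0 algebra_simps)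
        ultimately show ?thesis
          using 4 by (intro meets[of c 0 "- a"]) auto
      next
        case 3
        moreover have "eval3 F (b, - a, 0) = - (a * b) * ((- a) ^ m - s * b ^ m)"
          by (simp add: eval m0 algebra_simps)
        ultimately show ?thesis
          using 4 by (intro meets[of b "- a" 0]) auto
      qed
    qed
  qed
  then show ?thesis
    by (auto simp: blocking_curve_def blocking_set_def proj_lines_def curve_points_def F_def)
qed

text \<open>
  Polynomial consequences of polynomial equations, with explicit cofactors for the cases in which the
  search for them by \<^emph>\<open>Groebner_Basis.algebra\<close> (qualified because \<^emph>\<open>HOL-Algebra\<close> has another
  method of this name) fails.
\<close>

lemma lincomb2: "p = q \<Longrightarrow> p' = q' \<Longrightarrow> l - r - (a * (p - q) + b * (p' - q')) = 0 \<Longrightarrow> l = r"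
  for l :: "'a::comm_ring_1"
  by simp

lemma lincomb3:
  "p = q \<Longrightarrow> p' = q' \<Longrightarrow> p'' = q'' \<Longrightarrow>
   l - r - (a * (p - q) + b * (p' - q') + c * (p'' - q'')) = 0 \<Longrightarrow> l = r"
  for l :: "'a::comm_ring_1"
  by simp

lemma lincomb4:
  "p = q \<Longrightarrow> p' = q' \<Longrightarrow> p'' = q'' \<Longrightarrow> p''' = q''' \<Longrightarrow>
   l - r - (a * (p - q) + b * (p' - q') + c * (p'' - q'') + d * (p''' - q''')) = 0 \<Longrightarrow> l = r"
  for l :: "'a::comm_ring_1"
  by simp

subsection \<open>Singular points\<close>

text \<open>With q = 2m + 1, \<open>fr\<close> is the q-power Frobenius; it is additive when q is a
  power of the characteristic. Later the field is the algebraic closure.\<close>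

locale odd_frobenius =
  fixes fr :: "'k::field \<Rightarrow> 'k" and m :: nat
  assumes fr_eq: "fr a = a ^ (2 * m + 1)"
    and fr_add: "fr (a + b) = fr a + fr b"
    and m_ge_2: "m \<ge> 2"
    and of_nat_card: "of_nat (2 * m + 1) = (0::'k)"
    and two: "(2::'k) \<noteq> 0" and three: "(3::'k) \<noteq> 0"
begin

lemma fr_0: "fr 0 = 0" and fr_1: "fr 1 = 1"
  by (simp_all add: fr_eq)

lemma fr_minus: "fr (- a) = - fr a"
  by (simp add: fr_eq)

lemma fr_diff: "fr (a - b) = fr a - fr b"
  using fr_add[of a "- b"] by (simp add: fr_minus)

lemma fr_mult: "fr (a * b) = fr a * fr b"
  by (simp only: fr_eq power_mult_distrib)

lemma fr_power: "fr (a ^ n) = fr a ^ n"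
  by (simp only: fr_eq mult.commute flip: power_mult)

lemma fr_of_nat: "fr (of_nat n) = of_nat n"
  by (induction n) (simp_all add: fr_0 fr_1 fr_add)

lemma fr_numeral: "fr (numeral n) = numeral n"
  using fr_of_nat[of "numeral n"] by simp

lemmas fr_simps = fr_0 fr_1 fr_add fr_minus fr_diff fr_mult fr_power fr_numeral

lemma fr_eq_mult: "fr a = a * (a ^ m) ^ 2"
  by (simp add: fr_eq power_mult mult.commute)

text \<open>This form serves as Euler's criterion: if \<open>a ^ 2 = - (c ^ 2)\<close> with
  \<open>fr c = c\<close>, c nonzero and m odd, then \<open>fr a = - a\<close>.\<close>

lemma fr_eq_mult': "fr a = a * (a ^ 2) ^ m"
  by (simp add: fr_eq power_mult)

lemma fr_eq_0_iff: "fr a = 0 \<longleftrightarrow> a = 0"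
  by (auto simp: fr_eq)

lemma fr_cong: "a = b \<Longrightarrow> fr a = fr b"
  by simp

lemma two_of_nat_m: "2 * of_nat m = (- 1 :: 'k)"
  using of_nat_card by (simp add: eq_neg_iff_add_eq_0 add.commute)

lemma numeral_ne_0:
  "(4::'k) \<noteq> 0" "(8::'k) \<noteq> 0" "(9::'k) \<noteq> 0" "(36::'k) \<noteq> 0" "(48::'k) \<noteq> 0" "(64::'k) \<noteq> 0"
proof -
  have "(4::'k) = 2 ^ 2" "(8::'k) = 2 ^ 3" "(9::'k) = 3 ^ 2" "(36::'k) = 2 ^ 2 * 3 ^ 2"
    "(48::'k) = 2 ^ 4 * 3" "(64::'k) = 2 ^ 6"
    by simp_all
  then show "(4::'k) \<noteq> 0" "(8::'k) \<noteq> 0" "(9::'k) \<noteq> 0" "(36::'k) \<noteq> 0" "(48::'k) \<noteq> 0" "(64::'k) \<noteq> 0"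
    using two three by (metis mult_eq_0_iff power_not_zero)+
qed

section \<open>Singular points off the coordinate triangle\<close>

text \<open>
  The equations \<open>F = 0\<close>, \<open>2 x F\<^sub>x = 0\<close> and \<open>2 y F\<^sub>y = 0\<close> at \<open>(x, y, 1)\<close>, rewritten with
  \<open>2 m = - 1\<close>.
\<close>

definition torus_singular :: "'k \<Rightarrow> 'k \<Rightarrow> 'k \<Rightarrow> 'k \<Rightarrow> bool" where
  "torus_singular \<sigma> \<epsilon> x y \<longleftrightarrow>
    (y ^ m + 1) * (x * (y + 1) + y) + x ^ m * (x * (1 + \<sigma> * y) + \<epsilon> * y) = 0 \<and>
    2 * x * (y ^ m + 1) * (y + 1) + x ^ m * (x * (1 + \<sigma> * y) - \<epsilon> * y) = 0 \<and>
    y ^ m * (x * y - x + y) + 2 * y * (x + 1) + 2 * x ^ m * y * (\<sigma> * x + \<epsilon>) = 0"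

text \<open>
  The equations express \<open>x\<close>, \<open>u\<close>, \<open>v\<close> in terms of \<open>y\<close>, and Frobenius then gives a cubic equation
  for \<open>a = (y + 1)\<^sup>2 / y\<close> together with \<open>a\<^sup>q = (a + 12) / (4 a)\<close>. As \<open>a\<^sup>q\<close> is a root of the same cubic,
  \<open>a\<close> lies in the prime field, so \<open>a\<^sup>q = a\<close>, which is possible only in characteristic 7.
\<close>

lemma torus_char_ne_7:
  fixes x y :: 'k
  assumes xy: "x \<noteq> 0" "y \<noteq> 0" and seven: "(7::'k) \<noteq> 0"
  shows "\<not> torus_singular (- 1) 0 x y"
proof
  assume sing: "torus_singular (- 1) 0 x y"
  define u v fx fy where "u = x ^ m" and "v = y ^ m" and "fx = fr x" and "fy = fr y"
  have E1: "(v + 1) * (x * (y + 1) + y) + u * (x * (1 - y)) = 0"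
    and E2: "2 * x * (v + 1) * (y + 1) + u * (x * (1 - y)) = 0"
    and E3: "v * (x * y - x + y) + 2 * y * (x + 1) - 2 * u * x * y = 0"
    using sing by (simp_all add: torus_singular_def u_def v_def mult_ac)
  have FX: "fx = x * u ^ 2" and FY: "fy = y * v ^ 2"
    by (simp_all add: fx_def fy_def u_def v_def fr_eq_mult)
  have u0: "u \<noteq> 0"
    using xy by (simp add: u_def)
  have v_1: "v = 1" if "y = 1"
    using that by (simp add: v_def)
  have "v + 1 \<noteq> 0"
  proof
    assume "v + 1 = 0"
    moreover from this have "u * x * (1 - y) = 0"
      using E1 by simp
    then have "y = 1"
      using xy u0 by simp
    ultimately show False
      using v_1 two by simp
  qed
  moreover have "(v + 1) * (y - x * (y + 1)) = 0"
    using E1 E2 by Groebner_Basis.algebra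
  ultimately have xy1: "x * (y + 1) = y"
    by simp
  then have y1: "y + 1 \<noteq> 0"
    using xy by auto
  have y_1: "y - 1 \<noteq> 0"
  proof
    assume "y - 1 = 0"
    then have "8 * x = 0"
      using E2 v_1 by simp
    then show False
      using xy numeral_ne_0 by simp
  qed
  have "x * (u * (1 - y) + 2 * (v + 1) * (y + 1)) = 0"
    using E2 by Groebner_Basis.algebra
  then have ue: "u * (1 - y) + 2 * (v + 1) * (y + 1) = 0"
    using xy by simp
  have "2 * y * (v * y * (y + 3) + (3 * y + 1)) = 0"
    using E3 xy1 ue by Groebner_Basis.algebra
  then have ve: "v * y * (y + 3) + (3 * y + 1) = 0"
    using xy two by simp
  have "(y - 1) * (u * y * (y + 3) - 2 * (y + 1) ^ 2) = 0"
    using ue ve by Groebner_Basis.algebra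
  then have uf: "u * y * (y + 3) = 2 * (y + 1) ^ 2"
    using y_1 by simp
  have y3: "y + 3 \<noteq> 0"
  proof
    assume "y + 3 = 0"
    then have "y = - 3"
      by (simp add: eq_neg_iff_add_eq_0)
    with ve show False
      using numeral_ne_0 by simp
  qed
  have F1: "fy * y * (y + 3) ^ 2 = (3 * y + 1) ^ 2"
    using ve FY by Groebner_Basis.algebra
  have F2: "fx * (fy + 1) = fy"
    using fr_cong[OF xy1] by (simp add: fr_simps fx_def fy_def)
  \<comment> \<open>Eliminates x from the Frobenius image \<open>F2\<close> by \<open>FX\<close> and
    \<open>xy1\<close>; squaring \<open>uf\<close> then removes u as well.\<close>
  have "y * u ^ 2 * (fy + 1) = x * (y + 1) * u ^ 2 * (fy + 1)"
    unfolding xy1 ..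
  also have "\<dots> = fx * (fy + 1) * (y + 1)"
    unfolding FX by Groebner_Basis.algebra
  finally have F2b: "y * u ^ 2 * (fy + 1) = fy * (y + 1)"
    unfolding F2 .
  have F2c: "y ^ 2 * (y + 3) ^ 2 * (y * u ^ 2) = 4 * y * (y + 1) ^ 4"
    using uf by Groebner_Basis.algebra
  have "y * (y + 1) * (4 * (y + 1) ^ 3 * (fy + 1)) = y ^ 2 * (y + 3) ^ 2 * (y * u ^ 2) * (fy + 1)"
    unfolding F2c by Groebner_Basis.algebra
  also have "\<dots> = y ^ 2 * (y + 3) ^ 2 * (y * u ^ 2 * (fy + 1))"
    by Groebner_Basis.algebra
  also have "\<dots> = y * (y + 1) * (fy * y * (y + 3) ^ 2)"
    unfolding F2b by Groebner_Basis.algebra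
  also have "\<dots> = y * (y + 1) * (3 * y + 1) ^ 2"
    unfolding F1 ..
  finally have F3: "4 * (y + 1) ^ 3 * (fy + 1) = (3 * y + 1) ^ 2"
    using y1 xy by simp
  have F4: "(fy + 1) * y * (y + 3) ^ 2 = (y + 1) * (y ^ 2 + 14 * y + 1)"
    using F1 by Groebner_Basis.algebra
  have fy0: "fy \<noteq> 0"
    using xy by (simp add: fy_def fr_eq_0_iff)
  \<comment> \<open>\<open>E4\<close> below is palindromic in y, so it becomes a cubic in the
    invariant a of y -> 1/y.\<close>
  define a fa where "a = (y + 1) ^ 2 / y" and "fa = fr a"
  have a: "a * y = (y + 1) ^ 2"
    using xy by (simp add: a_def)
  have fa: "fa * fy = (fy + 1) ^ 2"
    using fr_cong[OF a] by (simp add: fr_simps fa_def fy_def)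
  have a0: "a \<noteq> 0"
    using a y1 by auto
  have "4 * (y + 1) ^ 4 * (y ^ 2 + 14 * y + 1) = 4 * (y + 1) ^ 3 * ((y + 1) * (y ^ 2 + 14 * y + 1))"
    by Groebner_Basis.algebra
  also have "\<dots> = (4 * (y + 1) ^ 3 * (fy + 1)) * (y * (y + 3) ^ 2)"
    unfolding F4[symmetric] by Groebner_Basis.algebra
  also have "\<dots> = y * ((3 * y + 1) * (y + 3)) ^ 2"
    unfolding F3 by Groebner_Basis.algebra
  finally have E4: "4 * (y + 1) ^ 4 * (y ^ 2 + 14 * y + 1) = y * ((3 * y + 1) * (y + 3)) ^ 2" .
  have "y ^ 3 * (4 * a ^ 2 * (a + 12) - (3 * a + 4) ^ 2) = 0"
    using a E4 by Groebner_Basis.algebra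
  then have G1: "4 * a ^ 2 * (a + 12) = (3 * a + 4) ^ 2"
    using xy by simp
  have "(y + 1) * y * (y + 3) ^ 2 * (fy * y * (4 * a * fa)) = (y + 1) * y * (y + 3) ^ 2 * (4 * (a * y) * (fa * fy))"
    by Groebner_Basis.algebra
  also have "\<dots> = (4 * (y + 1) ^ 3 * (fy + 1)) * ((fy + 1) * y * (y + 3) ^ 2)"
    unfolding a fa by Groebner_Basis.algebra
  also have "\<dots> = (fy * y * (y + 3) ^ 2) * ((y + 1) * (y ^ 2 + 14 * y + 1))"
    unfolding F3 F4 F1 ..
  also have "\<dots> = (y + 1) * y * (y + 3) ^ 2 * (fy * ((y + 1) ^ 2 + 12 * y))"
    by Groebner_Basis.algebra
  also have "\<dots> = (y + 1) * y * (y + 3) ^ 2 * (fy * y * (a + 12))"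
    unfolding a[symmetric] by Groebner_Basis.algebra
  finally have afa: "4 * a * fa = a + 12"
    using y1 y3 xy fy0 by simp
  have G2: "4 * fa ^ 2 * (fa + 12) = (3 * fa + 4) ^ 2"
    using fr_cong[OF G1] by (simp add: fr_simps fa_def)
  \<comment> \<open>The cubic \<open>G2\<close> with \<open>4 * a * fa\<close> replaced by
    \<open>a + 12\<close>, after multiplication by \<open>64 * a ^ 3\<close>.\<close>
  have "48 * (26 * a ^ 3 + 15 * a ^ 2 - 504 * a - 144) =
      64 * a ^ 3 * ((3 * fa + 4) ^ 2 - 4 * fa ^ 2 * (fa + 12)) + ((4 * a * fa) ^ 3 - (a + 12) ^ 3) * 4
      + 156 * a * ((4 * a * fa) ^ 2 - (a + 12) ^ 2) - 384 * a ^ 2 * (4 * a * fa - (a + 12))"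
    by Groebner_Basis.algebra
  also have "\<dots> = 0"
    using G2 afa by simp
  finally have G3: "26 * a ^ 3 + 15 * a ^ 2 - 504 * a - 144 = 0"
    using numeral_ne_0 by (metis mult_eq_0_iff)
  \<comment> \<open>Euclidean elimination between the two cubics, down to a linear equation with
    integer coefficients.\<close>
  have "2 * a * (5 * a ^ 2 + 168 * a + 144) = 0"
    by (rule lincomb2[OF G1 G3, where a = "9" and b = "- 1"], Groebner_Basis.algebra)
  then have H1: "5 * a ^ 2 + 168 * a + 144 = 0"
    using a0 two by simp
  have H2: "477 * a ^ 2 + 696 * a + 80 = 0"
    by (rule lincomb2[OF G1 G3, where a = "13" and b = "- 2"], Groebner_Basis.algebra)
  have "64 * (a * (1067 * a + 1356)) = 0"
    by (rule lincomb2[OF H1 H2, where a = "- 80" and b = "144"], Groebner_Basis.algebra)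
  then have lin: "1067 * a + 1356 = 0"
    using a0 numeral_ne_0 by simp
  have linf: "1067 * fa + 1356 = 0"
    using fr_cong[OF lin] by (simp add: fr_simps fa_def)
  have "1067 * (fa - a) = 0"
    using lin linf by Groebner_Basis.algebra
  \<comment> \<open>1067 and 1356 are coprime: 48 * 1356 - 61 * 1067 = 1.\<close>
  moreover have "(1067::'k) \<noteq> 0"
  proof
    assume n: "(1067::'k) = 0"
    have "(1::'k) = 0"
      by (rule lincomb2[OF lin n, where a = "48" and b = "- 48 * a - 61"], Groebner_Basis.algebra)
    then show False
      by simp
  qed
  ultimately have fa_a: "fa = a"
    by simp
  have "4 * (a - 52) = 0"
    using afa G1 fa_a by Groebner_Basis.algebra
  then have a52: "a = 52"
    using numeral_ne_0 by (metis mult_eq_0_iff right_minus_eq)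
  have "2 ^ 9 * 3 * 7 = (0::'k)"
    by (rule lincomb3[OF afa fa_a a52, where a = "1" and b = "- 208" and c = "- 4 * fa - 207"], Groebner_Basis.algebra)
  then show False
    using two three seven by (metis mult_eq_0_iff power_not_zero)
qed

text \<open>In characteristic 5 the element 2 is a square root of -1, so for odd m Frobenius would
  negate it instead of fixing it.\<close>

lemma five_ne_0:
  assumes odd: "odd m"
  shows "(5::'k) \<noteq> 0"
proof
  assume "(5::'k) = 0"
  moreover have "(5::'k) = 2 ^ 2 + 1"
    by simp
  ultimately have "(2::'k) ^ 2 = - 1"
    by (metis eq_neg_iff_add_eq_0)
  then have "fr 2 = - 2"
    unfolding fr_eq_mult' using odd by (simp only: minus_one_power_iff) simp
  then have "(2::'k) = - 2"
    by (simp only: fr_numeral)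
  then have "(4::'k) = 0"
    by (simp add: eq_neg_iff_add_eq_0)
  then show False
    using numeral_ne_0 by blast
qed

text \<open>
  Here \<open>s = x u\<close> satisfies \<open>(5 s + 4)\<^sup>2 = - 9\<close>. Since \<open>- 1\<close> is not a square in the field with
  \<open>2 m + 1\<close> elements, \<open>s\<close> is not in that field and Frobenius maps it to its conjugate \<open>1 / s\<close>.
\<close>

lemma torus_odd:
  fixes x y \<epsilon> :: 'k
  assumes xy: "x \<noteq> 0" "y \<noteq> 0" and odd: "odd m" and eps: "5 * \<epsilon> = 1"
  shows "\<not> torus_singular 1 \<epsilon> x y"
proof
  assume sing: "torus_singular 1 \<epsilon> x y"
  have five: "(5::'k) \<noteq> 0"
    using odd by (rule five_ne_0)
  define u v s fx fy fs where "u = x ^ m" and "v = y ^ m" and "s = x * u" and "fx = fr x" and "fy = fr y" and "fs = fr s"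
  have e1: "(v + 1) * (x * (y + 1) + y) + u * (x * (1 + y) + \<epsilon> * y) = 0"
    and e2: "2 * x * (v + 1) * (y + 1) + u * (x * (1 + y) - \<epsilon> * y) = 0"
    and e3: "v * (x * y - x + y) + 2 * y * (x + 1) + 2 * u * y * (x + \<epsilon>) = 0"
    using sing by (simp_all add: torus_singular_def u_def v_def mult_ac)
  have FX: "x * fx = s ^ 2" and FY: "fy = y * v ^ 2"
    by (simp_all add: fx_def fy_def s_def u_def v_def fr_eq_mult power2_eq_square)
  have u0: "u \<noteq> 0"
    using xy by (simp add: u_def)
  have LV: "5 * (x * (y + 1) + y) * (u + v + 1) = 4 * u * y"
    using e1 eps by Groebner_Basis.algebra
  have L0: "x * (y + 1) + y \<noteq> 0"
  proof
    assume q: "x * (y + 1) + y = 0"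
    have "4 * u * y = 0"
      using LV q by Groebner_Basis.algebra
    then show False
      using u0 xy numeral_ne_0 by simp
  qed
  have d2': "5 * (2 * x * (u + v + 1) + (x * (y + 1) + y) * v) = 0"
    using LV e3 eps by Groebner_Basis.algebra
  then have d2: "2 * x * (u + v + 1) + (x * (y + 1) + y) * v = 0"
    using five by (metis mult_eq_0_iff)
  have "5 * (2 * x * (u + v + 1) * y + (x * (y + 1) + y)) = 0"
    using LV e2 eps d2' by Groebner_Basis.algebra
  then have d3: "2 * x * (u + v + 1) * y + (x * (y + 1) + y) = 0"
    using five by (metis mult_eq_0_iff)
  have "(x * (y + 1) + y) * (v * y - 1) = 0"
    using d2 d3 by Groebner_Basis.algebra
  then have vy: "v * y = 1"
    using L0 by simp
  have "y * (2 * s + 3 * x * (v + 1) + 1) = 0"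
    using d3 vy s_def by Groebner_Basis.algebra
  then have s1: "2 * s + 3 * x * (v + 1) + 1 = 0"
    using xy by simp
  have d4: "x * (y + 1) + y = - (2 * x * (u + v + 1) * y)"
    using d3 by Groebner_Basis.algebra
  have d5: "5 * - (2 * x * (u + v + 1) * y) * (u + v + 1) = 4 * u * y"
    using LV unfolding d4 .
  have "2 * y * (5 * (x * (u + v + 1)) ^ 2 + 2 * s) = 0"
    using d5 s_def by Groebner_Basis.algebra
  then have s2': "5 * (x * (u + v + 1)) ^ 2 + 2 * s = 0"
    using two xy by simp
  have s2'': "3 * (x * (u + v + 1)) = s - 1"
    using s1 s_def by Groebner_Basis.algebra
  have s2: "5 * s ^ 2 + 8 * s + 5 = 0"
    using s2' s2'' by Groebner_Basis.algebra
  \<comment> \<open>Since \<open>v * y = 1\<close>, Frobenius interchanges y and v, and hence fixes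
    T below.\<close>
  have FYv: "fy = v"
    using FY vy by Groebner_Basis.algebra
  have fvv: "fr v * v = 1"
    using fr_cong[OF vy] FYv by (simp add: fr_simps fy_def)
  then have frv: "fr v = y"
    using vy by (metis mult.commute mult_cancel_left mult_zero_left zero_neq_one)
  have "(5 * s + 4) ^ 2 = - (3 ^ 2)"
    using s2 by Groebner_Basis.algebra
  moreover have "fr (5 * s + 4) = (5 * s + 4) * ((5 * s + 4) ^ 2) ^ m"
    by (rule fr_eq_mult')
  moreover have "(3 ^ 2) ^ m = (1::'k)"
    using fr_numeral[of "num.Bit1 num.One"] three by (simp add: fr_eq power_mult)
  ultimately have "fr (5 * s + 4) = - (5 * s + 4)"
    using odd by (simp only: power_minus_odd) simp
  then have S1: "5 * fs + 4 = - (5 * s + 4)"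
    by (simp add: fr_simps fs_def)
  have "5 * (s * fs - 1) = 0"
    using S1 s2 by Groebner_Basis.algebra
  then have sS: "s * fs = 1"
    using five by simp
  have S2: "2 * fs + 3 * fx * (y + 1) + 1 = 0"
    using fr_cong[OF s1] by (simp add: fr_simps fs_def fx_def frv)
  define T where "T = (v + 1) * (y + 1)"
  have frT: "fr T = T"
    using FYv by (simp add: T_def fr_simps frv fy_def)
  \<comment> \<open>The product of \<open>s1\<close> and its Frobenius image \<open>S2\<close>.
    Comparing \<open>T1\<close> with its own image will give s^4 = 1.\<close>
  have m1: "(2 * s + 1) * (2 * fs + 1) = 9 * s ^ 2 * T"
    using s1 S2 FX T_def by Groebner_Basis.algebra
  have "9 * (5 * s ^ 2 * T - 1) = 0"
    using m1 S1 sS by Groebner_Basis.algebra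
  then have T1: "5 * s ^ 2 * T = 1"
    using numeral_ne_0 by (metis mult_eq_0_iff right_minus_eq)
  have T2: "5 * fs ^ 2 * T = 1"
    using fr_cong[OF T1] frT by (simp add: fr_simps fs_def)
  have "(s ^ 2 - 1) * (s ^ 2 + 1) = 0"
    using T1 T2 sS by Groebner_Basis.algebra
  then consider "s ^ 2 = 1" | "s ^ 2 = - 1"
    by (auto simp: eq_neg_iff_add_eq_0)
  then show False
  proof cases
    case 1
    have "36 * s = 0"
      by (rule lincomb2[OF s2 1, where a = "10 * s - 8" and b = "- 50 * s - 40"], Groebner_Basis.algebra)
    then show ?thesis
      using numeral_ne_0 u0 xy by (simp add: s_def)
  next
    case 2
    have "8 * s = 0"
      by (rule lincomb2[OF s2 2, where a = "1" and b = "- 5"], Groebner_Basis.algebra)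
    then show ?thesis
      using numeral_ne_0 u0 xy by (simp add: s_def)
  qed
qed

text \<open>
  With \<open>a = 1 / (x u)\<close> and \<open>b = a\<^sup>q\<close> one gets \<open>x a = n(a)\<close> and \<open>y (a + 1)\<^sup>2 = n(a)\<close>, where
  \<open>n(t) = 1 - t - t\<^sup>2\<close>, so Frobenius gives two equations in \<open>a\<close> and \<open>b\<close>. Eliminating \<open>b\<close> modulo 7 leaves
  \<open>a = 3\<close>, \<open>a = 4\<close>, or a root \<open>a\<close> of a sextic, of which \<open>b\<close> must then be a root as well.
\<close>

lemma torus_char_7:
  fixes x y :: 'k
  assumes xy: "x \<noteq> 0" "y \<noteq> 0" and seven: "(7::'k) = 0"
  shows "\<not> torus_singular (- 1) (- 1) x y"
proof
  assume sing: "torus_singular (- 1) (- 1) x y"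
  define u v s fx fy where "u = x ^ m" and "v = y ^ m" and "s = x * u" and "fx = fr x" and "fy = fr y"
  have e1: "(v + 1) * (x * (y + 1) + y) + u * (x * (1 - y) - y) = 0"
    and e2: "2 * x * (v + 1) * (y + 1) + u * (x * (1 - y) + y) = 0"
    and e3: "v * (x * y - x + y) + 2 * y * (x + 1) - 2 * u * y * (x + 1) = 0"
    using sing by (simp_all add: torus_singular_def u_def v_def algebra_simps)
  have FX: "x * fx = s ^ 2" and FY: "fy = y * v ^ 2"
    by (simp_all add: fx_def fy_def s_def u_def v_def fr_eq_mult power2_eq_square)
  have u0: "u \<noteq> 0"
    using xy by (simp add: u_def)
  have Q: "x * (y + 1) + y \<noteq> 0"
  proof
    assume q: "x * (y + 1) + y = 0"
    have "u * (x * (1 - y) - y) = 0"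
      using e1 q by Groebner_Basis.algebra
    then have q': "x * (1 - y) - y = 0"
      using u0 by simp
    have "2 * x = 0"
      using q q' by Groebner_Basis.algebra
    then show False
      using xy two by simp
  qed
  have d: "(v + 1) * (y - x * (y + 1)) = 2 * u * y"
    using e1 e2 by Groebner_Basis.algebra
  have "(x * (y + 1) + y) * (v * x + x + 1) = 0"
    using d e3 by Groebner_Basis.algebra
  then have vx: "v * x + x + 1 = 0"
    using Q by simp
  have s1: "2 * s * y = x * y + x - y"
    using d vx s_def by Groebner_Basis.algebra
  have "u * (y ^ 2 * (x + 1) ^ 2 - x * (x - 4 * y)) = 0"
    using e1 e2 by Groebner_Basis.algebra
  then have s2: "y ^ 2 * (x + 1) ^ 2 = x * (x - 4 * y)"
    using u0 by simp
  have s0: "s \<noteq> 0"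
    using u0 xy by (simp add: s_def)
  have "2 ^ 2 * y ^ 2 * (x * s - (s ^ 2 - s - 1)) = 0"
    using s1 s2 by Groebner_Basis.algebra
  then have xs: "x * s = s ^ 2 - s - 1"
    using xy numeral_ne_0 by simp
  have "2 ^ 2 * y * (y * (1 + s) ^ 2 - x * s) = 0"
    using s1 s2 by Groebner_Basis.algebra
  then have ys: "y * (1 + s) ^ 2 = x * s"
    using xy numeral_ne_0 by simp
  have "2 * y * (y * (x + 1) * (1 + s) - x * (s - 1)) = 0"
    using s1 s2 by Groebner_Basis.algebra
  then have ys': "y * (x + 1) * (1 + s) = x * (s - 1)"
    using xy two by simp
  define a b where "a = 1 / s" and "b = fr a"
  have as: "a * s = 1"
    using s0 by (simp add: a_def)
  have bs: "b * fr s = 1"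
    using fr_cong[OF as] by (simp add: fr_simps b_def)
  have "s ^ 2 * (x * a - (1 - a - a ^ 2)) = 0"
    using as xs by Groebner_Basis.algebra
  then have xa: "x * a = 1 - a - a ^ 2"
    using s0 by simp
  have "s ^ 2 * (y * (a + 1) ^ 2 - (1 - a - a ^ 2)) = 0"
    using as xs ys by Groebner_Basis.algebra
  then have ya: "y * (a + 1) ^ 2 = 1 - a - a ^ 2"
    using s0 by simp
  have fxb: "fx * b = 1 - b - b ^ 2" and fyb: "fy * (b + 1) ^ 2 = 1 - b - b ^ 2"
    using fr_cong[OF xa] fr_cong[OF ya] by (simp_all add: fr_simps fx_def fy_def b_def)
  have a0: "a \<noteq> 0" and b0: "b \<noteq> 0"
    using as bs by auto
  have xxa: "x * fx * a ^ 2 = 1"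
    using FX as by Groebner_Basis.algebra
  have b1: "a * (1 - a - a ^ 2) * (1 - b - b ^ 2) = b"
    using xa fxb xxa by Groebner_Basis.algebra
  have "x * s * (y * v * (1 + s) - (1 - s)) = 0"
    using ys' vx by Groebner_Basis.algebra
  then have yv: "y * v * (1 + s) = 1 - s"
    using xy s0 by simp
  have "s * (y * v * (a + 1) - (a - 1)) = 0"
    using yv as by Groebner_Basis.algebra
  then have yva: "y * v * (a + 1) = a - 1"
    using s0 by simp
  have "y * (a + 1) ^ 2 * (fy * (b + 1) ^ 2) = (y * v * (a + 1)) ^ 2 * (b + 1) ^ 2"
    unfolding FY by Groebner_Basis.algebra
  then have n2: "(1 - a - a ^ 2) * (1 - b - b ^ 2) = (a - 1) ^ 2 * (b + 1) ^ 2"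
    unfolding ya fyb yva .
  have b2: "a * (1 - a) ^ 2 * (b + 1) ^ 2 = b"
    by (rule lincomb2[OF b1 n2, where a = "1" and b = "- a"], Groebner_Basis.algebra)
  \<comment> \<open>\<open>R1\<close> and \<open>R2\<close> are combinations of the quadratics
    \<open>b1\<close> and \<open>b2\<close> that are linear in b.\<close>
  have "a ^ 2 * b * ((1 - a) ^ 2 * (a ^ 2 + a - 1) * (2 * b + 3) - (2 * a - 1)) = 0"
    by (rule lincomb2[OF b1 b2, where a = "a ^ 3 - 2 * a ^ 2 + a" and b = "a ^ 3 + a ^ 2 - a"], Groebner_Basis.algebra)
  then have R1: "(1 - a) ^ 2 * (a ^ 2 + a - 1) * (2 * b + 3) = 2 * a - 1"
    using a0 b0 by simp
  have "a * (a * (1 - a) ^ 2 * (a ^ 2 + a - 1) * (b + 2) - b * (3 * a - 2)) = 0"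
    by (rule lincomb2[OF b1 b2, where a = "- (a ^ 3) + 2 * a ^ 2 - a" and b = "a ^ 3 + a ^ 2 - a"], Groebner_Basis.algebra)
  then have R2: "a * (1 - a) ^ 2 * (a ^ 2 + a - 1) * (b + 2) = b * (3 * a - 2)"
    using a0 by simp
  have "(a - 4) ^ 2 * ((a - 3) * (a ^ 6 + 2 * a ^ 5 + a ^ 3 + 4 * a ^ 2 + 4 * a + 4)) = 0"
    \<comment> \<open>The cofactor of \<open>seven\<close> absorbs the multiples of 7 by which the
      identity fails over the integers.\<close>
    by (rule lincomb3[OF R1 R2 seven, where a = "- (a ^ 5) + a ^ 4 + 2 * a ^ 3 - 3 * a ^ 2 - 3 * a - 2" and b = "2 * a ^ 4 - 2 * a ^ 3 + 3 * a ^ 2 - a - 2" and c = "- (a ^ 7 * b) - a ^ 8 + 2 * a ^ 6 * b + a ^ 7 + 3 * a ^ 5 * b + 7 * a ^ 6 - 7 * a ^ 4 * b - 10 * a ^ 5 + 3 * a ^ 3 * b - 9 * a ^ 4 + 11 * a ^ 3 - 9 * a ^ 2 - 4 * a - 28"], Groebner_Basis.algebra)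
  then consider "a = 4" | "a = 3" | "a ^ 6 + 2 * a ^ 5 + a ^ 3 + 4 * a ^ 2 + 4 * a + 4 = 0"
    by auto
  then show False
  proof cases
    case 1
    have ba: "b = 4"
      using 1 by (simp add: b_def fr_simps)
    have "(1::'k) = 0"
      by (rule lincomb4[OF R1 1 ba seven, where a = "3" and b = "a ^ 3 * b + 3 * a ^ 2 * b - 2 * a ^ 3 + 3 * a * b + a ^ 2 + a + b - 3" and c = "3" and d = "- (a ^ 4 * b) + a ^ 3 * b - a ^ 4 + 3 * a ^ 2 * b - a * b + 3 * a ^ 2 - 2 * a + b + 1"], Groebner_Basis.algebra)
    then show ?thesis
      by simp
  next
    case 2
    have ba: "b = 3"
      using 2 by (simp add: b_def fr_simps)
    have "(1::'k) = 0"
      by (rule lincomb4[OF R1 2 ba seven, where a = "- 1" and b = "2 * a ^ 3 * b - 3 * a ^ 2 * b + 3 * a ^ 3 + a * b - a ^ 2 - 2 * a + 2 * b + 1" and c = "- 3" and d = "a ^ 3 * b - 2 * a ^ 2 * b + a ^ 3 + a * b - a ^ 2 + b - 1"], Groebner_Basis.algebra)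
    then show ?thesis
      by simp
  next
    case 3
    have fb: "b ^ 6 + 2 * b ^ 5 + b ^ 3 + 4 * b ^ 2 + 4 * b + 4 = 0"
      using fr_cong[OF 3] by (simp add: fr_simps b_def)
    \<comment> \<open>Modulo the sextic, \<open>R1\<close> makes b a polynomial in a. Reducing the
      sextic in b then leaves the quartic \<open>r\<close>, coprime to the sextic in a modulo
      7.\<close>
    have r1: "b = 6 * a ^ 4 + 5 * a ^ 3 + 3 * a ^ 2 + 4 * a"
      by (rule lincomb3[OF R1 3 seven, where a = "3 * a ^ 3 - 3 * a ^ 2 + 2" and b = "a * b - 2 * a + 3 * b + 1" and c = "- (a ^ 7 * b) + a ^ 6 * b - a ^ 7 + 3 * a ^ 6 - 5 * a ^ 4 * b + a ^ 5 + 3 * a ^ 3 * b - 7 * a ^ 4 - 2 * a ^ 2 * b + 5 * a ^ 3 - 4 * a * b + a ^ 2 - 2 * a - b"], Groebner_Basis.algebra)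
    have r2: "b ^ 2 = 5 * a ^ 5 + a ^ 4 + 4 * a ^ 3 + 2 * a + 3"
      by (rule lincomb3[OF r1 3 seven, where a = "- (a ^ 4) - 2 * a ^ 3 + 3 * a ^ 2 - 3 * a + b" and b = "a ^ 2 + 2 * a + 1" and c = "- (a ^ 8) - 3 * a ^ 7 + a ^ 4 * b - 3 * a ^ 5 + a ^ 3 * b - 3 * a ^ 4 - 2 * a ^ 3 + a * b - 4 * a ^ 2 - 2 * a - 1"], Groebner_Basis.algebra)
    have r3: "b ^ 3 = 4 * a ^ 5 + a ^ 4 + 3 * a ^ 3 + 6 * a ^ 2 + 4 * a + 1"
      by (rule lincomb4[OF r1 r2 3 seven, where a = "2 * a ^ 2 * b - 2 * a * b - 2 * a ^ 2 - 2 * a - 3 * b - 3" and b = "- (2 * a ^ 2) + 2 * a + b + 3" and c = "- 3 * a - 2 * b + 2" and d = "2 * a ^ 6 * b - a ^ 7 + a ^ 5 * b - 3 * a ^ 4 * b - 3 * a ^ 5 - a ^ 3 * b - 3 * a ^ 4 - a ^ 2 * b - 2 * a ^ 3 - 3 * a ^ 2 + 2 * b"], Groebner_Basis.algebra)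
    have r': "(4 * a ^ 5 + a ^ 4 + 3 * a ^ 3 + 6 * a ^ 2 + 4 * a + 1) ^ 2 + (4 * a ^ 5 + a ^ 4 + 3 * a ^ 3 + 6 * a ^ 2 + 4 * a + 1) * (2 * (5 * a ^ 5 + a ^ 4 + 4 * a ^ 3 + 2 * a + 3) + 1) + 4 * (5 * a ^ 5 + a ^ 4 + 4 * a ^ 3 + 2 * a + 3) + 4 * b + 4 = 0"
      by (rule lincomb3[OF fb r2 r3, where a = "1" and b = "- 2 * b ^ 3 - 4" and c = "- (b ^ 3) - (4 * a ^ 5 + a ^ 4 + 3 * a ^ 3 + 6 * a ^ 2 + 4 * a + 1) - 2 * (5 * a ^ 5 + a ^ 4 + 4 * a ^ 3 + 2 * a + 3) - 1"], Groebner_Basis.algebra)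
    have r: "5 * a ^ 4 + 5 * a ^ 2 + 1 = 0"
      by (rule lincomb4[OF r' r1 3 seven, where a = "1" and b = "3" and c = "2 * a ^ 3 - 2 * a ^ 2 + 2 * a + 3" and d = "- (8 * a ^ 10) - 4 * a ^ 9 - 13 * a ^ 8 - 18 * a ^ 7 - 22 * a ^ 6 - 26 * a ^ 5 - 14 * a ^ 4 - 17 * a ^ 3 - 12 * a ^ 2 - 8 * a - b - 5"], Groebner_Basis.algebra)
    have "(1::'k) = 0"
      by (rule lincomb3[OF r 3 seven, where a = "- (3 * a ^ 5) - 2 * a ^ 4 - a ^ 2 + 3 * a" and b = "a ^ 3 + a ^ 2 - a + 2" and c = "2 * a ^ 9 + a ^ 8 + 2 * a ^ 7 + 2 * a ^ 6 - 3 * a ^ 5 - 3 * a ^ 3 - a ^ 2 - a - 1"], Groebner_Basis.algebra)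
    then show ?thesis
      by simp
  qed
qed

text \<open>On a side the equation is, away from the vertices, a binomial in m-th powers without
  multiple roots; each vertex has a nonzero derivative. Off the sides \<open>torus\<close>
  applies.\<close>

lemma triangle_curve_nonsingular:
  fixes \<sigma> \<epsilon> :: 'k
  assumes \<sigma>: "\<sigma> \<noteq> 0"
    and torus: "\<And>x y. x \<noteq> 0 \<Longrightarrow> y \<noteq> 0 \<Longrightarrow> \<not> torus_singular \<sigma> \<epsilon> x y"
    and nz: "(x, y, z) \<noteq> (0, 0, 0)" and z: "z = 0 \<or> z = 1"
    and F: "eval3 (triangle_curve m \<sigma> \<epsilon>) (x, y, z) = 0"
    and Fx: "eval3 (pderiv_x (triangle_curve m \<sigma> \<epsilon>)) (x, y, z) = 0"
    and Fy: "eval3 (pderiv_y (triangle_curve m \<sigma> \<epsilon>)) (x, y, z) = 0"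
    and Fz: "eval3 (pderiv_z (triangle_curve m \<sigma> \<epsilon>)) (x, y, z) = 0"
  shows False
proof -
  define h k :: 'k where "h = of_nat (m + 1)" and "k = of_nat m"
  have h: "2 * h = 1" and k: "2 * k = - 1"
    using two_of_nat_m by (simp_all add: h_def k_def distrib_left)
  have m0: "(0::'k) ^ m = 0" "(0::'k) ^ (m - 1) = 0"
    using m_ge_2 by (simp_all add: zero_power)
  have pow: "a ^ m = a * a ^ (m - 1)" for a :: 'k
    using m_ge_2 by (simp flip: power_Suc)
  note F = F[unfolded eval3_triangle_curve]
  note Fx = Fx[unfolded eval3_pderiv_triangle_curve, folded h_def k_def]
  note Fy = Fy[unfolded eval3_pderiv_triangle_curve, folded h_def k_def]
  note Fz = Fz[unfolded eval3_pderiv_triangle_curve, folded h_def k_def]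
  \<comment> \<open>As h = 1/2, these are the equations of a double root of the binomial
    \<open>a + b\<close>.\<close>
  have half: False if "a + b = 0" "h * a + b = 0" "b \<noteq> 0" for a b :: 'k
  proof -
    have "b = 0"
      by (rule lincomb3[OF that(1,2) h, where a = "- 1" and b = "2" and c = "- a"], Groebner_Basis.algebra)
    with that(3) show False ..
  qed
  consider "x = 0" | "x \<noteq> 0" "y = 0" | "x \<noteq> 0" "y \<noteq> 0" "z = 0" | "x \<noteq> 0" "y \<noteq> 0" "z = 1"
    using z by blast
  then show False
  proof cases
    case 1
    have y: "y \<noteq> 0"
      using Fy nz 1 by (auto simp: m0)
    moreover from this have z: "z \<noteq> 0"
      using Fz 1 by (auto simp: m0)
    moreover have "z * (h * y ^ m + z ^ m) = 0"
      using Fy 1 by (simp add: m0 algebra_simps)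
    ultimately show ?thesis
      using half[of "y ^ m" "z ^ m"] F 1 by (auto simp: m0)
  next
    case 2
    have z: "z \<noteq> 0"
      using Fz 2 by (auto simp: m0)
    moreover have "x * z * (z ^ m + x ^ m) = 0"
      using F 2 by (simp add: m0 algebra_simps)
    moreover have "x * (h * z ^ m + x ^ m) = 0"
      using Fz 2 by (simp add: m0 algebra_simps)
    ultimately show ?thesis
      using half[of "z ^ m" "x ^ m"] 2 by auto
  next
    case 3
    have "x * y * (\<sigma> * x ^ m + y ^ m) = 0"
      using F 3 by (simp add: m0 algebra_simps)
    moreover have "y * (h * (\<sigma> * x ^ m) + y ^ m) = 0"
      using Fx 3 by (simp add: m0 algebra_simps)
    ultimately show ?thesis
      using half[of "\<sigma> * x ^ m" "y ^ m"] 3 by auto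
  next
    case 4
    \<comment> \<open>Multiplying the derivatives by 2x and 2y turns the powers with exponent
      \<open>m - 1\<close> into u and v and clears h = 1/2 and k = -1/2.\<close>
    define u v u' v' where "u = x ^ m" and "v = y ^ m" and "u' = x ^ (m - 1)" and "v' = y ^ (m - 1)"
    have u: "u = x * u'" and v: "v = y * v'"
      unfolding u_def v_def u'_def v'_def by (rule pow)+
    have F1: "(v + 1) * (x * (y + 1) + y) + u * (x * (1 + \<sigma> * y) + \<epsilon> * y) = 0"
      and F2: "(v + 1) * (y + 1) + h * u * (1 + \<sigma> * y) + k * u' * \<epsilon> * y = 0"
      and F3: "h * v * (x + 1) + k * x * v' + (x + 1) + u * (\<sigma> * x + \<epsilon>) = 0"
      using F Fx Fy 4 by (simp_all add: u_def v_def u'_def v'_def)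
    have "2 * x * (v + 1) * (y + 1) + u * (x * (1 + \<sigma> * y) - \<epsilon> * y) = 0"
      unfolding u
      by (rule lincomb3[OF F2[unfolded u] h k, where a = "2 * x" and b = "- (x * (x * u') * (1 + \<sigma> * y))" and c = "- (x * u' * \<epsilon> * y)"], Groebner_Basis.algebra)
    moreover have "v * (x * y - x + y) + 2 * y * (x + 1) + 2 * u * y * (\<sigma> * x + \<epsilon>) = 0"
      unfolding v
      by (rule lincomb3[OF F3[unfolded v] h k, where a = "2 * y" and b = "- (y * (y * v') * (x + 1))" and c = "- (x * y * v')"], Groebner_Basis.algebra)
    ultimately have "torus_singular \<sigma> \<epsilon> x y"
      using F1 unfolding torus_singular_def u_def v_def by blast
    with torus 4 show ?thesis
      by blast
  qed
qed

end

section \<open>Smoothness over the algebraic closure and choice of the coefficients\<close>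

lemma smooth_triangle_curve:
  fixes \<sigma> \<epsilon> :: "'a::field" and fr :: "'a alg_closure \<Rightarrow> 'a alg_closure"
  assumes frob: "odd_frobenius fr m" and \<sigma>: "\<sigma> \<noteq> 0"
    and torus: "\<And>x y. x \<noteq> 0 \<Longrightarrow> y \<noteq> 0 \<Longrightarrow> \<not> odd_frobenius.torus_singular m (to_ac \<sigma>) (to_ac \<epsilon>) x y"
  shows "smooth_curve (triangle_curve m \<sigma> \<epsilon>)"
proof -
  let ?F = "triangle_curve m (to_ac \<sigma>) (to_ac \<epsilon>)"
  have False
    if P: "P \<in> curve_points ?F" "vanishes_at (pderiv_x ?F) P" "vanishes_at (pderiv_y ?F) P"
      "vanishes_at (pderiv_z ?F) P" for P
  proof -
    obtain x y z where xyz: "P = hpoint (x, y, z)" "(x, y, z) \<noteq> (0, 0, 0)"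
      using P(1) unfolding curve_points_def proj_plane_def by auto
    define c where "c = (if z = 0 then 1 else 1 / z)"
    have c: "c \<noteq> 0"
      by (simp add: c_def)
    then have "(c * x, c * y, c * z) \<in> P"
      by (auto simp: xyz hpoint_def)
    moreover have "vanishes_at ?F P"
      using P(1) by (simp add: curve_points_def)
    moreover have "(c * x, c * y, c * z) \<noteq> (0, 0, 0)"
      using c xyz(2) by simp
    moreover have "c * z = 0 \<or> c * z = 1"
      by (simp add: c_def)
    moreover have "to_ac \<sigma> \<noteq> 0"
      using \<sigma> by simp
    ultimately show False
      using odd_frobenius.triangle_curve_nonsingular[OF frob, of "to_ac \<sigma>" "to_ac \<epsilon>" "c * x" "c * y" "c * z"] torus P(2-4)
      unfolding vanishes_at_def by blast
  qed
  then show ?thesis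
    unfolding smooth_curve_def base_change_triangle_curve by blast
qed

theorem theorem1p8:
  fixes q p :: nat
  assumes "CARD('a::finite_field) = q" and "CHAR('a) = p"
    and "primepow q" and "q \<ge> 5" and "p > 3"
  shows "\<exists>F :: 'a poly3. plane_curve ((q + 3) div 2) F \<and> smooth_curve F \<and> blocking_curve F"
proof -
  have p: "prime p"
    using assms(2) CHAR_prime[where 'a = 'a] by simp
  have "p dvd q"
    using CHAR_dvd_CARD[where 'a = 'a] assms(1,2) by simp
  moreover obtain r n where rn: "prime r" "n > 0" "q = r ^ n"
    using assms(3) unfolding primepow_def by auto
  ultimately have q: "q = p ^ n"
    using p by (metis prime_dvd_power primes_dvd_imp_eq)
  have "odd q"
    using p assms(5) prime_odd_nat[of p] by (simp add: q)
  then obtain m where m: "q = 2 * m + 1"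
    by (rule oddE)
  then have m2: "m \<ge> 2"
    using assms(4) by simp
  have deg: "(q + 3) div 2 = m + 2"
    using m by simp
  have dvd: "(of_nat k = (0 :: 'a alg_closure)) \<longleftrightarrow> p dvd k" for k
    using of_nat_eq_0_iff_char_dvd[where 'a = "'a alg_closure", of k] assms(2) by simp
  have small: "\<not> p dvd 2" "\<not> p dvd 3"
    using assms(5) by (auto dest: dvd_imp_le)
  have frob: "odd_frobenius (\<lambda>x :: 'a alg_closure. x ^ q) m"
  proof
    show "(a + b) ^ q = a ^ q + b ^ q" for a b :: "'a alg_closure"
      using freshmans_dream'[where 'a = "'a alg_closure", of q n a b] p q assms(2) by simp
    show "of_nat (2 * m + 1) = (0 :: 'a alg_closure)"
      using \<open>p dvd q\<close> unfolding dvd m .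
    show "(2 :: 'a alg_closure) \<noteq> 0" "(3 :: 'a alg_closure) \<noteq> 0"
      using dvd[of 2] dvd[of 3] small by simp_all
  qed (use m m2 in simp_all)
  have two: "(2 :: 'a) \<noteq> 0"
    using of_nat_eq_0_iff_char_dvd[where 'a = 'a, of 2] assms(2) small by simp
  have "\<exists>\<epsilon> :: 'a. smooth_curve (triangle_curve m (- ((- 1) ^ m)) \<epsilon>)"
  \<comment> \<open>The coefficient \<open>- ((- 1) ^ m)\<close> is 1 for odd m and -1 for even
    m.\<close>
  proof (cases "odd m")
    case True
    have "(5 :: 'a) \<noteq> 0"
      using odd_frobenius.five_ne_0[OF frob True] to_ac_eq_0_iff[of "5 :: 'a"] by simp
    then obtain \<epsilon> :: 'a where "5 * \<epsilon> = 1"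
      by (metis dvd_field_iff dvdE)
    then have "5 * to_ac \<epsilon> = 1"
      by (metis to_ac_1 to_ac_mult to_ac_numeral)
    then have "smooth_curve (triangle_curve m (- ((- 1) ^ m)) \<epsilon>)"
      using True odd_frobenius.torus_odd[OF frob] by (intro smooth_triangle_curve[OF frob]) auto
    then show ?thesis ..
  next
    case False
    show ?thesis
    proof (cases "p = 7")
      case True
      then have "(7 :: 'a alg_closure) = 0"
        using dvd[of 7] by simp
      then have "smooth_curve (triangle_curve m (- ((- 1) ^ m)) (- 1 :: 'a))"
        using False odd_frobenius.torus_char_7[OF frob] by (intro smooth_triangle_curve[OF frob]) auto
      then show ?thesis ..
    next
      case p7: False
      have "\<not> p dvd 7"
        using p p7 primes_dvd_imp_eq[of p 7] by auto
      then have "(7 :: 'a alg_closure) \<noteq> 0"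
        using dvd[of 7] by simp
      then have "smooth_curve (triangle_curve m (- ((- 1) ^ m)) (0 :: 'a))"
        using False odd_frobenius.torus_char_ne_7[OF frob] by (intro smooth_triangle_curve[OF frob]) auto
      then show ?thesis ..
    qed
  qed
  then obtain \<epsilon> :: 'a where "smooth_curve (triangle_curve m (- ((- 1) ^ m)) \<epsilon>)" ..
  then show ?thesis
    using plane_curve_triangle_curve[OF m2] blocking_triangle_curve[OF _ m2 two] assms(1) m
    unfolding deg by blast
qed

end
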